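(* For every real number $x\in(0,1.371)$, $$\frac{\tan x}{x}<\frac{\pi^{2}-\left(4-\frac{1}{3}\pi^{2}\right)x^{2}-\left(\frac{4}{3}-\frac{2}{15}\pi^{2}\right)x^{4}}{\pi^{2}-4x^{2}}.$$
   Context: The number $1.371$ is an exact decimal constant. *)

theory Defs
  imports Complex_Main
begin

end

(* Write q = pi^2. After clearing denominators the difference of the two sides is affine in q with
   leading coefficient x cos x (1 + x^2/3 + 2 x^4/15) - sin x, which is negative because the
   quintic Taylor polynomial of tan lies below tan. So q may be replaced by the slightly larger
   9.87, and Taylor bounds for sin and cos then leave x^7 times a polynomial in x^2 that is
   positive on the interval. *)
theory Submission
  imports Defs "HOL-Analysis.Complex_Transcendental"
begin

text \<open>The Taylor terms of degree below 9 miss sin x by at most x^9/9!, and this error bound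
  becomes the last term.\<close>

lemma sin_le_Taylor9:
  fixes x :: real
  assumes "0 \<le> x"
  shows "sin x \<le> x - x^3/6 + x^5/120 - x^7/5040 + x^9/362880"
proof -
  have "(\<Sum>m<9. sin_coeff m * x^m) = x - x^3/6 + x^5/120 - x^7/5040"
    by (simp add: sin_coeff_def lessThan_nat_numeral fact_numeral)
  moreover have "inverse (fact 9) * \<bar>x\<bar>^9 = x^9/362880"
    using assms by (simp add: fact_numeral)
  ultimately show ?thesis
    using Maclaurin_sin_bound[of x 9] by linarith
qed

text \<open>The Lagrange remainder of order 10 is a cosine value times x^10/10!, hence at least
  -x^10/10!.\<close>

lemma Taylor10_le_cos:
  fixes x :: real
  shows "1 - x^2/2 + x^4/24 - x^6/720 + x^8/40320 - x^10/3628800 \<le> cos x"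
proof -
  obtain t where
    t: "cos x = (\<Sum>m<10. cos_coeff m * x^m) + cos (t + 1/2 * real 10 * pi) / fact 10 * x^10"
    using Maclaurin_cos_expansion[of x 10] by blast
  have "(-1) * (x^10 / fact 10) \<le> cos (t + 1/2 * real 10 * pi) * (x^10 / fact 10)"
    by (rule mult_right_mono) auto
  moreover have "(\<Sum>m<10. cos_coeff m * x^m) = 1 - x^2/2 + x^4/24 - x^6/720 + x^8/40320"
    by (simp add: cos_coeff_def lessThan_nat_numeral fact_numeral)
  ultimately show ?thesis
    unfolding t by (simp add: fact_numeral)
qed

text \<open>The bound must stay below 168/17 = 9.882..., where the constant term -17q/315 + 8/15 of
  \<open>q * a + b\<close> vanishes.\<close>

lemma pi_squared_less: "pi\<^sup>2 < 987/100"
proof -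
  have "pi \<le> 3.1416" using pi_approx by simp
  then have "pi\<^sup>2 \<le> 3.1416\<^sup>2" by (intro power_mono) auto
  then show ?thesis by (simp add: power2_eq_square)
qed

lemma pi_squared_greater: "9 < pi\<^sup>2"
proof -
  have "3 < pi" using pi_approx by simp
  then have "3\<^sup>2 < pi\<^sup>2" by (intro power_strict_mono) auto
  then show ?thesis by simp
qed

theorem theorem2:
  fixes x :: real
  assumes "x \<in> {0<..<1.371}"
  shows "tan x / x <
    (pi\<^sup>2 - (4 - 1 / 3 * pi\<^sup>2) * x\<^sup>2 - (4 / 3 - 2 / 15 * pi\<^sup>2) * x ^ 4) / (pi\<^sup>2 - 4 * x\<^sup>2)"
proof -
  define q where "q = pi\<^sup>2"
  define u where "u = x\<^sup>2"
  define P where "P = q - (4 - 1/3 * q) * u - (4/3 - 2/15 * q) * u^2"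
  \<comment> \<open>\<open>C\<close> and \<open>S\<close> are the bounds for cos x and sin x / x,
    written in \<open>u\<close>.\<close>
  define C where "C = 1 - u/2 + u^2/24 - u^3/720 + u^4/40320 - u^5/3628800"
  define S where "S = 1 - u/6 + u^2/120 - u^3/5040 + u^4/362880"
  have x: "0 < x" "x < 1.371" using assms by auto
  have q: "9 < q" "q < 987/100"
    using pi_squared_less pi_squared_greater by (auto simp: q_def)
  have "x\<^sup>2 < 1.371\<^sup>2" using x by (intro power_strict_mono) auto
  then have u: "0 < u" "u < 47/25" using x by (auto simp: u_def power2_eq_square)
  have D: "0 < q - 4 * u" using q u by simp
  \<comment> \<open>Since q > 9, the coefficients are below 1 and 2/15. Positivity of
    \<open>P\<close> later allows \<open>C\<close> to be replaced by cos x.\<close>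
  have "(4 - 1/3 * q) * u \<le> 1 * u" "(4/3 - 2/15 * q) * u^2 \<le> (2/15) * u^2"
    using q u by (auto intro!: mult_right_mono)
  moreover have "u^2 \<le> 4" using power_mono[of u 2 2] u by simp
  ultimately have P: "0 < P" using q u unfolding P_def by linarith
  have cos: "0 < cos x" using x pi_approx by (intro cos_gt_zero_pi) auto

  define a where
    "a = -17/315 + 29/5670 * u - 643/3628800 * u^2 + 1/311040 * u^3 - 1/27216000 * u^4"
  define b where
    "b = 8/15 - 16/315 * u + 1/567 * u^2 - 29/907200 * u^3 + 1/2721600 * u^4"
  \<comment> \<open>The factor u^3 appears because P = (q - 4u)(1 + u/3 + 2u^2/15) + 8u^3/15, where
    the bracket is the Taylor polynomial of tan x / x.\<close>
  have "P * C - (q - 4 * u) * S = u^3 * (q * a + b)"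
    unfolding P_def C_def S_def a_def b_def by (simp add: eval_nat_numeral) argo
  moreover have "0 < q * a + b"
  proof -
    have u2: "u^3 = u * u^2" "u^4 = u^2 * u^2" by (auto simp: eval_nat_numeral)
    \<comment> \<open>With \<open>u^2\<close> and \<open>u^2 * u^2\<close> as atoms the bounds
      become linear: for \<open>a\<close> and for the quartic, the cubic term is absorbed by the
      quadratic one, and the linear part already has the right sign for u < 47/25.\<close>
    have "u * u^2 \<le> 47/25 * u^2" "0 \<le> u^2 * u^2" using u by (auto intro!: mult_right_mono)
    then have "a \<le> 0" and "0 < 1/1500 - 59/189000 * u + 5359/362880000 * u^2
        - 17/72576000 * u^3 + 13/2721600000 * u^4"
      using u zero_le_power2[of u] unfolding a_def u2 by linarith+
    moreover have "987/100 * a + b = 1/1500 - 59/189000 * u + 5359/362880000 * u^2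
        - 17/72576000 * u^3 + 13/2721600000 * u^4"
      by (simp add: a_def b_def algebra_simps)
    moreover have "987/100 * a \<le> q * a" using q \<open>a \<le> 0\<close> by (intro mult_right_mono_neg) auto
    ultimately show ?thesis by linarith
  qed
  ultimately have "0 < P * C - (q - 4 * u) * S" using u by simp
  then have "x * ((q - 4 * u) * S) < x * (P * C)" using x by simp
  moreover have "(q - 4 * u) * sin x \<le> (q - 4 * u) * (x * S)"
  proof (rule mult_left_mono)
    have "x * S = x - x^3/6 + x^5/120 - x^7/5040 + x^9/362880"
      by (simp add: S_def u_def algebra_simps flip: power_mult power_Suc)
    then show "sin x \<le> x * S" using sin_le_Taylor9[of x] x by simp
  qed (use D in simp)
  moreover have "x * (P * C) \<le> x * (P * cos x)"
  proof (intro mult_left_mono)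
    have "C = 1 - x^2/2 + x^4/24 - x^6/720 + x^8/40320 - x^10/3628800"
      by (simp add: C_def u_def flip: power_mult)
    then show "C \<le> cos x" using Taylor10_le_cos[of x] by simp
  qed (use x P in simp_all)
  ultimately have "(q - 4 * u) * sin x < x * P * cos x" by (simp add: mult_ac)
  then have "tan x / x < P / (q - 4 * u)"
    using D x cos by (simp add: tan_def field_simps)
  then show ?thesis
    by (simp add: P_def q_def u_def flip: power_mult)
qed

end
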